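(* Let $n\ge 2$ be an integer, let $\epsilon>0$ be real, and let $G$ be the adjacency matrix of a simple directed graph on $n$ vertices. Then $$\max_{Q\in Q_t\cup Q_{nt}}\langle G,Q\rangle=n(1+\epsilon)$$ if and only if the graph $G$ is Hamiltonian.
   Context: A simple directed graph on vertices $1,\dots,n$ has no loops and no multiple arcs (both arcs $(i,j)$ and $(j,i)$ with $i\neq j$ may be present); it is identified with its $n\times n$ $0/1$ adjacency matrix $G$, which has zero diagonal. It is Hamiltonian if it contains a directed cycle through all $n$ vertices. For $n\times n$ real matrices, $\langle A,B\rangle=\sum_{i,j}A[i,j]B[i,j]$. $P$ is the set of all $n!$ permutation matrices of size $n\times n$. $P_t\subset P$ is the set of the $(n-1)!$ permutation matrices of $n$-cycles ("tours": viewed as adjacency matrices, they are directed Hamilton cycles), and $P_{nt}=P\setminus P_t$ ("non-tours"). Let $\overline{B_n}$ be the $n\times n$ matrix with all entries equal to $1/n$. Define $$Q_t=\{(1+\epsilon)X : X\in P_t\},\qquad Q_{nt}=\{X+\epsilon\,\overline{B_n} : X\in P_{nt}\}.$$ *)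

theory Defs
  imports
    "HOL-Analysis.Analysis"
    "HOL-Combinatorics.Orbits"
    "Graph_Theory.Arc_Walk"
begin

text \<open>The vertices visited by a closed walk are the tails of its arcs; a cycle visits each of them once.\<close>

definition (in pre_digraph) hamiltonian :: bool where
  "hamiltonian \<longleftrightarrow> (\<exists>p. cycle p \<and> tail G ` set p = verts G)"

definition adjacency_matrix :: "('n, 'e) pre_digraph \<Rightarrow> real ^ 'n ^ 'n" where
  "adjacency_matrix D = (\<chi> i j. if (i, j) \<in> arcs_ends D then 1 else 0)"

definition permutation_matrix :: "('n \<Rightarrow> 'n) \<Rightarrow> real ^ 'n ^ 'n" where
  "permutation_matrix \<pi> = (\<chi> i j. if j = \<pi> i then 1 else 0)"

definition permutation_matrices :: "(real ^ 'n ^ 'n) set" where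
  "permutation_matrices = {permutation_matrix \<pi> | \<pi>. \<pi> permutes UNIV}"

definition tours :: "(real ^ 'n ^ 'n) set" where
  "tours = {permutation_matrix \<pi> | \<pi>. \<pi> permutes UNIV \<and> cyclic_on \<pi> UNIV}"

definition nontours :: "(real ^ 'n ^ 'n) set" where
  "nontours = permutation_matrices - tours"

definition uniform_matrix :: "real ^ 'n ^ 'n" where
  "uniform_matrix = (\<chi> i j. 1 / real CARD('n))"

definition scaled_tours :: "real \<Rightarrow> (real ^ 'n ^ 'n) set" where
  "scaled_tours \<epsilon> = {(1 + \<epsilon>) *\<^sub>R X | X. X \<in> tours}"

definition shifted_nontours :: "real \<Rightarrow> (real ^ 'n ^ 'n) set" where
  "shifted_nontours \<epsilon> = {X + \<epsilon> *\<^sub>R uniform_matrix | X. X \<in> nontours}"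

text \<open>The inner product of the Euclidean space \<^typ>\<open>real ^ 'n ^ 'n\<close> is the entrywise one.\<close>

lemma matrix_inner_eq_sum:
  fixes A B :: "real ^ 'n ^ 'n"
  shows "A \<bullet> B = (\<Sum>i\<in>UNIV. \<Sum>j\<in>UNIV. A $ i $ j * B $ i $ j)"
  by (simp add: inner_vec_def)

text \<open>\<^const>\<open>Max\<close> is only meaningful on finite nonempty sets.\<close>

lemma permutation_matrices_eq_image:
  "(permutation_matrices :: (real ^ 'n ^ 'n) set) = permutation_matrix ` {\<pi>. \<pi> permutes UNIV}"
  by (auto simp: permutation_matrices_def)

lemma tours_subset_permutation_matrices: "tours \<subseteq> permutation_matrices"
  by (auto simp: tours_def permutation_matrices_def)

lemma finite_permutation_matrices: "finite (permutation_matrices :: (real ^ 'n ^ 'n) set)"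
  unfolding permutation_matrices_eq_image by (intro finite_imageI finite_permutations) simp

lemma finite_scaled_tours_Un_shifted_nontours:
  "finite (scaled_tours \<epsilon> \<union> shifted_nontours \<epsilon> :: (real ^ 'n ^ 'n) set)"
proof -
  have "finite (tours :: (real ^ 'n ^ 'n) set)" "finite (nontours :: (real ^ 'n ^ 'n) set)"
    unfolding nontours_def
    using finite_permutation_matrices finite_subset[OF tours_subset_permutation_matrices] by auto
  then show ?thesis
    by (simp add: scaled_tours_def shifted_nontours_def)
qed

lemma scaled_tours_Un_shifted_nontours_nonempty:
  "(scaled_tours \<epsilon> \<union> shifted_nontours \<epsilon> :: (real ^ 'n ^ 'n) set) \<noteq> {}"
proof -
  have "permutation_matrix id \<in> (permutation_matrices :: (real ^ 'n ^ 'n) set)"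
    using permutes_id by (auto simp: permutation_matrices_def)
  then show ?thesis
    by (auto simp: scaled_tours_def shifted_nontours_def nontours_def)
qed

end

(*
A permutation matrix meets G in at most n entries, with equality iff all arcs (i, pi i) are in D.
Since D has no loops, G has at most n (n - 1) ones, so a shifted non-tour scores at most
n + eps (n - 1) < n (1 + eps). Hence n (1 + eps) is an upper bound for all scores, and it can be
attained only by a tour all of whose arcs lie in D, that is, by a Hamiltonian cycle.
*)
theory Submission
  imports Defs "HOL-Combinatorics.Cycles"
begin

text \<open>The \<open>k\<close>-th power of \<open>cycle_of_list cs\<close> rotates
  \<open>cs\<close> by \<open>k\<close> places, so it sends the head to \<open>cs ! k\<close>; the
  orbit of the head therefore runs through the whole list.\<close>

lemma cyclic_on_cycle_of_list:
  assumes "distinct cs" "cs \<noteq> []"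
  shows "cyclic_on (cycle_of_list cs) (set cs)"
proof (rule cyclic_on_singleI)
  let ?f = "cycle_of_list cs"
  have pow: "(?f ^^ k) (hd cs) = cs ! k" if "k < length cs" for k
  proof -
    have "(?f ^^ k) (hd cs) = hd (map (?f ^^ k) cs)"
      using assms by (simp add: hd_map)
    also have "\<dots> = hd (rotate k cs)"
      using cyclic_rotation[OF assms(1)] by simp
    finally show ?thesis
      using assms that by (simp add: hd_rotate_conv_nth)
  qed
  have "(?f ^^ length cs) (hd cs) = hd cs"
    using cycle_is_id_root[OF assms(1)] by simp
  \<comment> \<open>Any positive return time bounds the iterates needed to fill an orbit, and
    \<open>length cs\<close> is one.\<close>
  then have "orbit ?f (hd cs) = {(?f ^^ k) (hd cs) | k. k < length cs}"
    using assms by (intro orbit_altdef_bounded) auto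
  then show "set cs = orbit ?f (hd cs)"
    unfolding set_conv_nth using pow by (intro set_eqI) (simp, metis)
qed (use assms in simp)

text \<open>Along a closed walk the heads are the tails rotated by one place, so the cycle built
  from the list of tails moves each tail to its head.\<close>

lemma (in wf_digraph) cyclic_permutation_of_cycle:
  assumes "cycle p"
  obtains \<pi> where "\<pi> permutes tail G ` set p" "cyclic_on \<pi> (tail G ` set p)"
    "\<And>e. e \<in> set p \<Longrightarrow> \<pi> (tail G e) = head G e"
proof -
  obtain u where p: "awalk u p u" "distinct (tl (awalk_verts u p))" "p \<noteq> []"
    using assms by (auto simp: cycle_def)
  then have cas: "cas u p u"
    by (auto simp: awalk_def)
  \<comment> \<open>Both sides are the vertex list of the walk, read once by tails and once by
    heads.\<close>
  have "map (tail G) p @ [head G (last p)] = tail G (hd p) # map (head G) p"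
    using awalk_verts_conv[of u p] awalk_verts_conv'[OF cas] p(3) by simp
  moreover have "head G (last p) = tail G (hd p)"
    using cas awalk_verts_conv[of u p] awlast_if_cas[OF cas] awhd_if_cas[OF cas] p(3)
    by (simp add: hd_map)
  ultimately have rot: "rotate1 (map (tail G) p) = map (head G) p"
    using p(3) by (cases p) auto
  \<comment> \<open>\<open>cycle\<close> only asks for distinctness after dropping the first vertex,
    which concerns the heads; the rotation carries it over to the tails.\<close>
  have heads: "distinct (map (head G) p)"
    using p(2,3) awalk_verts_conv'[OF cas] by simp
  then have tails: "distinct (map (tail G) p)"
    by (metis distinct1_rotate rot)
  let ?\<pi> = "cycle_of_list (map (tail G) p)"
  have "map ?\<pi> (map (tail G) p) = map (head G) p"
    using cyclic_rotation[OF tails, of 1] rot by simp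
  then have "\<And>e. e \<in> set p \<Longrightarrow> ?\<pi> (tail G e) = head G e"
    by simp
  then show ?thesis
    using that[of ?\<pi>] cyclic_on_cycle_of_list[OF tails] p(3) cycle_permutes[of "map (tail G) p"]
    by simp
qed

text \<open>Choose an arc from each \<open>v\<close> to \<open>\<pi> v\<close> and follow these arcs
  from a vertex \<open>s\<close> until \<pi> first returns to it.\<close>

lemma (in wf_digraph) cycle_of_cyclic_permutation:
  assumes perm: "\<pi> permutes verts G" and cyc: "cyclic_on \<pi> (verts G)"
    and arcs: "\<And>v. v \<in> verts G \<Longrightarrow> (v, \<pi> v) \<in> arcs_ends G"
  obtains p where "cycle p" "tail G ` set p = verts G"
proof -
  obtain a where a: "\<And>v. v \<in> verts G \<Longrightarrow> a v \<in> arcs G \<and> tail G (a v) = v \<and> head G (a v) = \<pi> v"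
    using arcs unfolding arcs_ends_conv image_iff by (metis prod.inject)
  obtain s where s: "s \<in> verts G" "verts G = orbit \<pi> s"
    using cyc by (auto simp: cyclic_on_def)
  \<comment> \<open>The least positive return time of \<open>s\<close>: the iterates below
    \<open>n\<close> reach every vertex, each exactly once.\<close>
  define n where "n = funpow_dist1 \<pi> s s"
  have pow_n: "(\<pi> ^^ n) s = s"
    unfolding n_def using s by (intro funpow_dist1_prop) simp
  have verts: "verts G = (\<lambda>k. (\<pi> ^^ k) s) ` {0..<n}"
    unfolding n_def using s orbit_conv_funpow_dist1[of s \<pi>] by simp
  have inj: "inj_on (\<lambda>k. (\<pi> ^^ k) s) {0..<n}"
    unfolding n_def using s by (intro inj_on_funpow_dist1) simp
  have in_verts: "(\<pi> ^^ k) s \<in> verts G" for k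
    using cyc s(1) by (rule cyclic_on_funpow_in)
  define p where "p = map (\<lambda>k. a ((\<pi> ^^ k) s)) [0..<n]"
  \<comment> \<open>\<open>cas\<close> recurses from the front, whereas the walk below grows at its
    end.\<close>
  have cas_append: "cas u (q @ [e]) v \<longleftrightarrow> cas u q (tail G e) \<and> v = head G e" for u q e v
    by (induction q arbitrary: u) auto
  have "cas s (map (\<lambda>k. a ((\<pi> ^^ k) s)) [0..<m]) ((\<pi> ^^ m) s)" for m
    by (induction m) (simp_all add: cas_append a in_verts del: cas_append_iff)
  then have cas: "cas s p s"
    unfolding p_def using pow_n by metis
  have "p \<noteq> []"
    by (simp add: p_def n_def)
  have walk: "awalk s p s"
    using cas s(1) a in_verts by (auto simp: awalk_def p_def)
  have "tl (awalk_verts s p) = map (head G) p"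
    using awalk_verts_conv'[OF cas] \<open>p \<noteq> []\<close> by simp
  \<comment> \<open>The heads are the \<pi>-images of distinct vertices, and \<pi> is injective;
    this gives the distinctness that \<open>cycle\<close> requires.\<close>
  also have "\<dots> = map \<pi> (map (\<lambda>k. (\<pi> ^^ k) s) [0..<n])"
    by (simp add: p_def a in_verts)
  also have "distinct \<dots>"
    using inj permutes_inj_on[OF perm] by (simp add: distinct_map comp_inj_on)
  finally have "cycle p"
    using walk \<open>p \<noteq> []\<close> by (auto simp: cycle_def)
  moreover have "tail G ` set p = verts G"
    by (simp add: p_def image_image a in_verts verts[symmetric])
  ultimately show ?thesis
    by (rule that)
qed

text \<open>The bridge from graphs, where a cycle is a list of arcs, to matrices, where a tour is a
  cyclic permutation.\<close>

lemma (in wf_digraph) hamiltonian_iff_cyclic_permutation: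
  "hamiltonian \<longleftrightarrow> (\<exists>\<pi>. \<pi> permutes verts G \<and> cyclic_on \<pi> (verts G) \<and>
    (\<forall>v\<in>verts G. (v, \<pi> v) \<in> arcs_ends G))"
proof
  assume hamiltonian
  then obtain p where p: "cycle p" "tail G ` set p = verts G"
    by (auto simp: hamiltonian_def)
  obtain \<pi> where \<pi>: "\<pi> permutes verts G" "cyclic_on \<pi> (verts G)"
    "\<And>e. e \<in> set p \<Longrightarrow> \<pi> (tail G e) = head G e"
    using cyclic_permutation_of_cycle[OF p(1)] p(2) by metis
  have "set p \<subseteq> arcs G"
    using p(1) by (auto simp: cycle_def awalk_def)
  then have "(v, \<pi> v) \<in> arcs_ends G" if "v \<in> verts G" for v
    using that \<pi>(3) unfolding p(2)[symmetric] arcs_ends_conv by auto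
  with \<pi> show "\<exists>\<pi>. \<pi> permutes verts G \<and> cyclic_on \<pi> (verts G) \<and>
      (\<forall>v\<in>verts G. (v, \<pi> v) \<in> arcs_ends G)"
    by blast
next
  assume "\<exists>\<pi>. \<pi> permutes verts G \<and> cyclic_on \<pi> (verts G) \<and>
    (\<forall>v\<in>verts G. (v, \<pi> v) \<in> arcs_ends G)"
  then show hamiltonian
    unfolding hamiltonian_def by (metis cycle_of_cyclic_permutation)
qed

text \<open>Row \<open>i\<close> of the permutation matrix has its only 1 in column
  \<open>\<pi> i\<close>, so each row contributes a single entry of the adjacency matrix.\<close>

lemma adjacency_inner_permutation_matrix:
  fixes D :: "('n::finite, 'e) pre_digraph"
  shows "adjacency_matrix D \<bullet> permutation_matrix \<pi> = real (card {i. (i, \<pi> i) \<in> arcs_ends D})"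
proof -
  have "adjacency_matrix D \<bullet> permutation_matrix \<pi> =
      (\<Sum>i\<in>UNIV. if (i, \<pi> i) \<in> arcs_ends D then 1 else 0)"
    by (simp add: matrix_inner_eq_sum adjacency_matrix_def permutation_matrix_def
      if_distrib[of "(*) _"] cong: if_cong)
  then show ?thesis
    by (simp add: sum.If_cases)
qed

lemma adjacency_inner_permutation_matrix_le:
  fixes D :: "('n::finite, 'e) pre_digraph"
  shows "adjacency_matrix D \<bullet> permutation_matrix \<pi> \<le> real CARD('n)"
  unfolding adjacency_inner_permutation_matrix by (simp add: card_mono)

lemma adjacency_inner_permutation_matrix_eq_iff:
  fixes D :: "('n::finite, 'e) pre_digraph"
  shows "adjacency_matrix D \<bullet> permutation_matrix \<pi> = real CARD('n) \<longleftrightarrow>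
    (\<forall>i. (i, \<pi> i) \<in> arcs_ends D)"
  unfolding adjacency_inner_permutation_matrix of_nat_eq_iff
  using card_subset_eq[of UNIV "{i. (i, \<pi> i) \<in> arcs_ends D}"] by auto

text \<open>Each row would sum to 1 if it were full of arcs, but the zero on the diagonal makes it
  fall short. This strictness is what keeps shifted non-tours below the maximum.\<close>

lemma adjacency_inner_uniform_matrix_less:
  fixes D :: "('n::finite, 'e) pre_digraph"
  assumes "loopfree_digraph D"
  shows "adjacency_matrix D \<bullet> uniform_matrix < real CARD('n)"
proof -
  interpret loopfree_digraph D by fact
  have "(\<Sum>j\<in>UNIV. adjacency_matrix D $ i $ j * uniform_matrix $ i $ j) < 1" for i
  proof -
    have "(\<Sum>j\<in>UNIV. adjacency_matrix D $ i $ j * uniform_matrix $ i $ j)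
        < (\<Sum>j\<in>(UNIV::'n set). 1 / real CARD('n))"
    proof (rule sum_strict_mono_ex1)
      have "(i, i) \<notin> arcs_ends D"
        using no_loops by (auto simp: arcs_ends_conv)
      then show "\<exists>j\<in>UNIV. adjacency_matrix D $ i $ j * uniform_matrix $ i $ j < 1 / real CARD('n)"
        by (intro bexI[of _ i]) (simp_all add: adjacency_matrix_def)
    qed (auto simp: adjacency_matrix_def uniform_matrix_def)
    then show ?thesis by simp
  qed
  then have "adjacency_matrix D \<bullet> uniform_matrix < (\<Sum>i\<in>(UNIV::'n set). 1)"
    unfolding matrix_inner_eq_sum by (intro sum_strict_mono) auto
  then show ?thesis by simp
qed

theorem lemma2p2:
  fixes D :: "('n::finite, 'e) pre_digraph"
    and G :: "real ^ 'n ^ 'n"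
    and \<epsilon> :: real
  assumes "CARD('n) \<ge> 2"
    and "\<epsilon> > 0"
    and "digraph D"
    and "verts D = UNIV"
    and "G = adjacency_matrix D"
  shows "Max {G \<bullet> Q | Q. Q \<in> scaled_tours \<epsilon> \<union> shifted_nontours \<epsilon>} = real CARD('n) * (1 + \<epsilon>)
    \<longleftrightarrow> pre_digraph.hamiltonian D"
proof -
  interpret digraph D by fact
  let ?S = "scaled_tours \<epsilon> \<union> shifted_nontours \<epsilon> :: (real ^ 'n ^ 'n) set"
  let ?M = "real CARD('n) * (1 + \<epsilon>)"
  have tour_le: "G \<bullet> Q \<le> ?M" if "Q \<in> scaled_tours \<epsilon>" for Q
    using that assms(2) adjacency_inner_permutation_matrix_le[of D]
    by (auto simp: scaled_tours_def tours_def assms(5) mult.commute[of "1 + \<epsilon>"]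
        intro!: mult_right_mono)
  have nontour_less: "G \<bullet> Q < ?M" if Q: "Q \<in> shifted_nontours \<epsilon>" for Q
  proof -
    obtain \<pi> where Q_eq: "Q = permutation_matrix \<pi> + \<epsilon> *\<^sub>R uniform_matrix"
      using Q unfolding shifted_nontours_def nontours_def permutation_matrices_def by blast
    have "\<epsilon> * (G \<bullet> uniform_matrix) < \<epsilon> * real CARD('n)"
      using assms(2,5) adjacency_inner_uniform_matrix_less[of D] loopfree_digraph_axioms by simp
    then show ?thesis
      using adjacency_inner_permutation_matrix_le[of D \<pi>]
      by (simp add: Q_eq assms(5) inner_add_right algebra_simps)
  qed
  have image: "{G \<bullet> Q | Q. Q \<in> ?S} = (\<bullet>) G ` ?S"
    by auto
  have "Max {G \<bullet> Q | Q. Q \<in> ?S} = ?M \<longleftrightarrow>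
      ?M \<in> (\<bullet>) G ` ?S \<and> (\<forall>x\<in>(\<bullet>) G ` ?S. x \<le> ?M)"
    unfolding image
    by (intro Max_eq_iff finite_imageI finite_scaled_tours_Un_shifted_nontours)
      (simp only: image_is_empty scaled_tours_Un_shifted_nontours_nonempty not_False_eq_True)
  \<comment> \<open>The upper bound always holds, and non-tours stay strictly below it, so only
    attainment by a scaled tour remains.\<close>
  also have "\<dots> \<longleftrightarrow> (\<exists>Q\<in>scaled_tours \<epsilon>. G \<bullet> Q = ?M)"
  proof
    assume "?M \<in> (\<bullet>) G ` ?S \<and> (\<forall>x\<in>(\<bullet>) G ` ?S. x \<le> ?M)"
    then obtain Q where "Q \<in> ?S" "G \<bullet> Q = ?M"
      by (metis imageE)
    then show "\<exists>Q\<in>scaled_tours \<epsilon>. G \<bullet> Q = ?M"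
      using nontour_less[of Q] by auto
  next
    assume "\<exists>Q\<in>scaled_tours \<epsilon>. G \<bullet> Q = ?M"
    then show "?M \<in> (\<bullet>) G ` ?S \<and> (\<forall>x\<in>(\<bullet>) G ` ?S. x \<le> ?M)"
      using tour_le nontour_less by (auto intro: less_imp_le simp: image_iff eq_commute[of ?M])
  qed
  also have "\<dots> \<longleftrightarrow> (\<exists>\<pi>. \<pi> permutes UNIV \<and> cyclic_on \<pi> (UNIV :: 'n set) \<and>
      G \<bullet> permutation_matrix \<pi> = real CARD('n))"
  proof -
    have "(\<exists>Q\<in>scaled_tours \<epsilon>. G \<bullet> Q = ?M) \<longleftrightarrow>
        (\<exists>\<pi>. \<pi> permutes UNIV \<and> cyclic_on \<pi> (UNIV :: 'n set) \<and>
          G \<bullet> ((1 + \<epsilon>) *\<^sub>R permutation_matrix \<pi>) = ?M)"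
      \<comment> \<open>The scalar stays inside the inner product so that the scaled matrix itself
        can serve as the witness \<open>Q\<close>.\<close>
      by (force simp: scaled_tours_def tours_def simp del: inner_scaleR_right)
    \<comment> \<open>The factor \<open>1 + \<epsilon>\<close> is positive and cancels.\<close>
    then show ?thesis
      using assms(2) by simp
  qed
  also have "\<dots> \<longleftrightarrow> hamiltonian"
    unfolding hamiltonian_iff_cyclic_permutation assms(4,5)
      adjacency_inner_permutation_matrix_eq_iff by simp
  finally show ?thesis .
qed

end
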